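(* Let $X$ be a Hausdorff topological space and $Y$ a Banach space. Let $\tau$ be any one of the topologies $\tau_p$ (pointwise convergence), $\tau_{UC}$ (uniform convergence on compact sets), $\tau_U$ (uniform convergence). Then the map $\varphi$ from $(MU(X,Y),\tau)$ onto $(MC(X,Y),\tau)$, defined by $\varphi(F)(x)=\overline{co}\,F(x)$ for all $x\in X$, is continuous.
   Context: A set-valued map $F$ from $X$ to $Y$ assigns to each $x\in X$ a subset $F(x)\subset Y$. Write $G\subset F$ if $G(x)\subset F(x)$ for all $x\in X$. $F$ is upper semicontinuous if for every $x\in X$ and every open $V\supset F(x)$ there is an open neighborhood $U$ of $x$ with $F(u)\subset V$ for all $u\in U$. $F$ is usco if it is upper semicontinuous and all its values are nonempty and compact; $F$ is cusco if it is usco and all its values are convex. $F$ is minimal usco (minimal cusco) if it is usco (cusco) and does not properly contain any other usco (cusco) map from $X$ to $Y$. $MU(X,Y)$ and $MC(X,Y)$ denote the sets of all minimal usco and all minimal cusco maps from $X$ to $Y$, respectively. $\overline{co}\,B$ denotes the closed convex hull of $B$. $Y$ carries the metric $d$ induced by its norm. For nonempty closed $A,B\subset Y$, let $e_d(A,B)=\sup\{d(a,B):a\in A\}$, where $d(a,B)=\inf_{b\in B}d(a,b)$, and let $H_d(A,B)=\max\{e_d(A,B),e_d(B,A)\}$ (the extended-valued Hausdorff metric). Let $F(X,Y)$ be the set of all set-valued maps from $X$ to $Y$ with nonempty closed values. The topology $\tau_p$ on $F(X,Y)$ is induced by the uniformity with base $\{(\Phi,\Psi): H_d(\Phi(x),\Psi(x))<\varepsilon\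 \forall x\in A\}$, with $A\subset X$ nonempty finite and $\varepsilon>0$. The topology $\tau_{UC}$ is induced by the uniformity with base $\{(\Phi,\Psi): H_d(\Phi(x),\Psi(x))<\varepsilon\ \forall x\in K\}$, with $K\subset X$ nonempty compact and $\varepsilon>0$. The topology $\tau_U$ is generated by the extended-valued metric $\varrho(\Phi,\Psi)=\sup\{H_d(\Phi(x),\Psi(x)):x\in X\}$. $MU(X,Y)$ and $MC(X,Y)$ carry the corresponding subspace topologies. *)

theory Defs
  imports "HOL-Analysis.Analysis"
begin

text \<open>A set-valued map from \<open>X\<close> to \<open>Y\<close> is a function \<open>'a \<Rightarrow> 'b set\<close>; the inclusion
  \<open>G \<subset> F\<close> of set-valued maps is the pointwise order \<open>G \<le> F\<close> on functions.\<close>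

definition usc :: "('a::topological_space \<Rightarrow> 'b::topological_space set) \<Rightarrow> bool" where
  "usc F \<longleftrightarrow> (\<forall>x V. open V \<and> F x \<subseteq> V \<longrightarrow> (\<exists>U. open U \<and> x \<in> U \<and> (\<forall>u\<in>U. F u \<subseteq> V)))"

definition usco :: "('a::topological_space \<Rightarrow> 'b::topological_space set) \<Rightarrow> bool" where
  "usco F \<longleftrightarrow> usc F \<and> (\<forall>x. F x \<noteq> {} \<and> compact (F x))"

definition cusco :: "('a::topological_space \<Rightarrow> 'b::real_normed_vector set) \<Rightarrow> bool" where
  "cusco F \<longleftrightarrow> usco F \<and> (\<forall>x. convex (F x))"

definition MU :: "('a::topological_space \<Rightarrow> 'b::topological_space set) set" where
  "MU = {F. usco F \<and> \<not> (\<exists>G. usco G \<and> G \<le> F \<and> G \<noteq> F)}"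

definition MC :: "('a::topological_space \<Rightarrow> 'b::real_normed_vector set) set" where
  "MC = {F. cusco F \<and> \<not> (\<exists>G. cusco G \<and> G \<le> F \<and> G \<noteq> F)}"

definition closed_valued :: "('a \<Rightarrow> 'b::topological_space set) set" where
  "closed_valued = {F. \<forall>x. F x \<noteq> {} \<and> closed (F x)}"

definition excess :: "'b::metric_space set \<Rightarrow> 'b set \<Rightarrow> ennreal" where
  "excess A B = (SUP a\<in>A. ennreal (infdist a B))"

definition Hausdorff_edist :: "'b::metric_space set \<Rightarrow> 'b set \<Rightarrow> ennreal" where
  "Hausdorff_edist A B = max (excess A B) (excess B A)"

definition sup_edist :: "('a \<Rightarrow> 'b::metric_space set) \<Rightarrow> ('a \<Rightarrow> 'b set) \<Rightarrow> ennreal" where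
  "sup_edist \<Phi> \<Psi> = (SUP x. Hausdorff_edist (\<Phi> x) (\<Psi> x))"

text \<open>The topology on \<open>S\<close> induced by the uniformity with base \<open>\<B>\<close>. A base of a uniformity is
  downward directed, which is what makes these sets a topology.\<close>

definition uniform_topology :: "'f set \<Rightarrow> ('f \<times> 'f) set set \<Rightarrow> 'f topology" where
  "uniform_topology S \<B> = topology (\<lambda>U. U \<subseteq> S \<and> (\<forall>\<Phi>\<in>U. \<exists>B\<in>\<B>. B `` {\<Phi>} \<subseteq> U))"

lemma openin_uniform_topology:
  assumes total: "\<forall>B\<in>\<B>. B \<subseteq> S \<times> S" and "\<B> \<noteq> {}"
    and directed: "\<forall>B\<in>\<B>. \<forall>C\<in>\<B>. \<exists>D\<in>\<B>. D \<subseteq> B \<inter> C"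
  shows "openin (uniform_topology S \<B>) U \<longleftrightarrow> U \<subseteq> S \<and> (\<forall>\<Phi>\<in>U. \<exists>B\<in>\<B>. B `` {\<Phi>} \<subseteq> U)"
    and "topspace (uniform_topology S \<B>) = S"
proof -
  let ?P = "\<lambda>U. U \<subseteq> S \<and> (\<forall>\<Phi>\<in>U. \<exists>B\<in>\<B>. B `` {\<Phi>} \<subseteq> U)"
  have "?P (U \<inter> V)" if U: "?P U" and V: "?P V" for U V
  proof (intro conjI ballI)
    show "U \<inter> V \<subseteq> S" using U by blast
    fix \<Phi> assume "\<Phi> \<in> U \<inter> V"
    then obtain B C where "B \<in> \<B>" "B `` {\<Phi>} \<subseteq> U" "C \<in> \<B>" "C `` {\<Phi>} \<subseteq> V"
      using U V by (meson IntD1 IntD2)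
    moreover then obtain D where "D \<in> \<B>" "D \<subseteq> B \<inter> C" using directed by meson
    ultimately show "\<exists>D\<in>\<B>. D `` {\<Phi>} \<subseteq> U \<inter> V" by (intro bexI[of _ D]) blast+
  qed
  moreover have "?P (\<Union>K)" if K: "\<forall>U\<in>K. ?P U" for K
  proof (intro conjI ballI)
    show "\<Union>K \<subseteq> S" using K by blast
    fix \<Phi> assume "\<Phi> \<in> \<Union>K"
    then obtain U where U: "U \<in> K" "\<Phi> \<in> U" by blast
    then obtain B where "B \<in> \<B>" "B `` {\<Phi>} \<subseteq> U" using K by meson
    then show "\<exists>B\<in>\<B>. B `` {\<Phi>} \<subseteq> \<Union>K" using U by blast
  qed
  ultimately have "istopology ?P" unfolding istopology_def by blast
  then have *: "openin (uniform_topology S \<B>) = ?P"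
    by (simp add: uniform_topology_def)
  then show "openin (uniform_topology S \<B>) U \<longleftrightarrow> ?P U" by simp
  have "?P S" using total \<open>\<B> \<noteq> {}\<close> by blast
  then show "topspace (uniform_topology S \<B>) = S"
    unfolding topspace_def * by blast
qed

definition entourage ::
  "'a set \<Rightarrow> real \<Rightarrow> (('a \<Rightarrow> 'b::metric_space set) \<times> ('a \<Rightarrow> 'b set)) set" where
  "entourage A \<epsilon> = {(\<Phi>, \<Psi>) \<in> closed_valued \<times> closed_valued.
     \<forall>x\<in>A. Hausdorff_edist (\<Phi> x) (\<Psi> x) < ennreal \<epsilon>}"

definition tau_p :: "('a \<Rightarrow> 'b::metric_space set) topology" where
  "tau_p = uniform_topology closed_valued {entourage A \<epsilon> | A \<epsilon>. A \<noteq> {} \<and> finite A \<and> 0 < \<epsilon>}"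

definition tau_UC :: "('a::topological_space \<Rightarrow> 'b::metric_space set) topology" where
  "tau_UC = uniform_topology closed_valued {entourage K \<epsilon> | K \<epsilon>. K \<noteq> {} \<and> compact K \<and> 0 < \<epsilon>}"

definition sup_entourage ::
  "real \<Rightarrow> (('a \<Rightarrow> 'b::metric_space set) \<times> ('a \<Rightarrow> 'b set)) set" where
  "sup_entourage \<epsilon> = {(\<Phi>, \<Psi>) \<in> closed_valued \<times> closed_valued. sup_edist \<Phi> \<Psi> < ennreal \<epsilon>}"

text \<open>The topology generated by the extended-valued metric \<open>sup_edist\<close>: the image of \<open>\<Phi>\<close> under
  \<open>sup_entourage \<epsilon>\<close> is the open \<open>\<epsilon>\<close>-ball around \<open>\<Phi>\<close>.\<close>

definition tau_U :: "('a \<Rightarrow> 'b::metric_space set) topology" where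
  "tau_U = uniform_topology closed_valued {sup_entourage \<epsilon> | \<epsilon>. 0 < \<epsilon>}"

lemma entourage_antimono:
  "A \<subseteq> A' \<Longrightarrow> \<epsilon>' \<le> \<epsilon> \<Longrightarrow> entourage A' \<epsilon>' \<subseteq> entourage A \<epsilon>"
  unfolding entourage_def
  by (clarsimp) (meson ennreal_leI order_less_le_trans subsetD)

lemma sup_entourage_mono: "\<epsilon>' \<le> \<epsilon> \<Longrightarrow> sup_entourage \<epsilon>' \<subseteq> sup_entourage \<epsilon>"
  unfolding sup_entourage_def
  by clarsimp (meson ennreal_leI order_less_le_trans)

lemma openin_tau_p:
  fixes U :: "('a \<Rightarrow> 'b::metric_space set) set"
  shows "openin tau_p U \<longleftrightarrow> U \<subseteq> closed_valued \<and>
     (\<forall>\<Phi>\<in>U. \<exists>A \<epsilon>. A \<noteq> {} \<and> finite A \<and> 0 < \<epsilon> \<and> entourage A \<epsilon> `` {\<Phi>} \<subseteq> U)"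
  and topspace_tau_p: "topspace (tau_p :: ('a \<Rightarrow> 'b set) topology) = closed_valued"
proof -
  let ?B = "{entourage A \<epsilon> :: (('a \<Rightarrow> 'b set) \<times> ('a \<Rightarrow> 'b set)) set | A \<epsilon>. A \<noteq> {} \<and> finite A \<and> 0 < \<epsilon>}"
  have 1: "\<forall>B\<in>?B. B \<subseteq> closed_valued \<times> closed_valued"
    by (auto simp: entourage_def)
  have "entourage {undefined} 1 \<in> ?B"
    by (rule CollectI, rule exI[of _ "{undefined}"], rule exI[of _ 1]) simp
  then have 2: "?B \<noteq> {}" by blast
  have 3: "\<forall>B\<in>?B. \<forall>C\<in>?B. \<exists>D\<in>?B. D \<subseteq> B \<inter> C"
  proof (intro ballI)
    fix B C assume "B \<in> ?B" "C \<in> ?B"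
    obtain A \<epsilon> A' \<epsilon>' where *: "B = entourage A \<epsilon>" "C = entourage A' \<epsilon>'" "A \<noteq> {}" "finite A" "finite A'"
      "0 < \<epsilon>" "0 < \<epsilon>'" using \<open>B \<in> ?B\<close> \<open>C \<in> ?B\<close> by blast
    have "entourage (A \<union> A') (min \<epsilon> \<epsilon>') \<subseteq> B \<inter> C"
      unfolding * by (rule Int_greatest; rule entourage_antimono; simp)
    moreover have "entourage (A \<union> A') (min \<epsilon> \<epsilon>') \<in> ?B"
      by (rule CollectI, rule exI[of _ "A \<union> A'"], rule exI[of _ "min \<epsilon> \<epsilon>'"])
        (use * in \<open>simp add: compact_Un\<close>)
    ultimately show "\<exists>D\<in>?B. D \<subseteq> B \<inter> C" by blast
  qed
  show "openin tau_p U \<longleftrightarrow> U \<subseteq> closed_valued \<and>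
     (\<forall>\<Phi>\<in>U. \<exists>A \<epsilon>. A \<noteq> {} \<and> finite A \<and> 0 < \<epsilon> \<and> entourage A \<epsilon> `` {\<Phi>} \<subseteq> U)"
    unfolding tau_p_def openin_uniform_topology(1)[of ?B, OF 1 2 3] by blast
  show "topspace (tau_p :: ('a \<Rightarrow> 'b set) topology) = closed_valued"
    unfolding tau_p_def by (rule openin_uniform_topology(2)[of ?B, OF 1 2 3])
qed

lemma openin_tau_UC:
  fixes U :: "('a::topological_space \<Rightarrow> 'b::metric_space set) set"
  shows "openin tau_UC U \<longleftrightarrow> U \<subseteq> closed_valued \<and>
     (\<forall>\<Phi>\<in>U. \<exists>K \<epsilon>. K \<noteq> {} \<and> compact K \<and> 0 < \<epsilon> \<and> entourage K \<epsilon> `` {\<Phi>} \<subseteq> U)"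
  and topspace_tau_UC: "topspace (tau_UC :: ('a \<Rightarrow> 'b set) topology) = closed_valued"
proof -
  let ?B = "{entourage A \<epsilon> :: (('a \<Rightarrow> 'b set) \<times> ('a \<Rightarrow> 'b set)) set | A \<epsilon>. A \<noteq> {} \<and> compact A \<and> 0 < \<epsilon>}"
  have 1: "\<forall>B\<in>?B. B \<subseteq> closed_valued \<times> closed_valued"
    by (auto simp: entourage_def)
  have "entourage {undefined} 1 \<in> ?B"
    by (rule CollectI, rule exI[of _ "{undefined}"], rule exI[of _ 1]) simp
  then have 2: "?B \<noteq> {}" by blast
  have 3: "\<forall>B\<in>?B. \<forall>C\<in>?B. \<exists>D\<in>?B. D \<subseteq> B \<inter> C"
  proof (intro ballI)
    fix B C assume "B \<in> ?B" "C \<in> ?B"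
    obtain A \<epsilon> A' \<epsilon>' where *: "B = entourage A \<epsilon>" "C = entourage A' \<epsilon>'" "A \<noteq> {}" "compact A" "compact A'"
      "0 < \<epsilon>" "0 < \<epsilon>'" using \<open>B \<in> ?B\<close> \<open>C \<in> ?B\<close> by blast
    have "entourage (A \<union> A') (min \<epsilon> \<epsilon>') \<subseteq> B \<inter> C"
      unfolding * by (rule Int_greatest; rule entourage_antimono; simp)
    moreover have "entourage (A \<union> A') (min \<epsilon> \<epsilon>') \<in> ?B"
      by (rule CollectI, rule exI[of _ "A \<union> A'"], rule exI[of _ "min \<epsilon> \<epsilon>'"])
        (use * in \<open>simp add: compact_Un\<close>)
    ultimately show "\<exists>D\<in>?B. D \<subseteq> B \<inter> C" by blast
  qed
  show "openin tau_UC U \<longleftrightarrow> U \<subseteq> closed_valued \<and>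
     (\<forall>\<Phi>\<in>U. \<exists>K \<epsilon>. K \<noteq> {} \<and> compact K \<and> 0 < \<epsilon> \<and> entourage K \<epsilon> `` {\<Phi>} \<subseteq> U)"
    unfolding tau_UC_def openin_uniform_topology(1)[of ?B, OF 1 2 3] by blast
  show "topspace (tau_UC :: ('a \<Rightarrow> 'b set) topology) = closed_valued"
    unfolding tau_UC_def by (rule openin_uniform_topology(2)[of ?B, OF 1 2 3])
qed

lemma openin_tau_U:
  fixes U :: "('a \<Rightarrow> 'b::metric_space set) set"
  shows "openin tau_U U \<longleftrightarrow> U \<subseteq> closed_valued \<and>
     (\<forall>\<Phi>\<in>U. \<exists>\<epsilon>>0. sup_entourage \<epsilon> `` {\<Phi>} \<subseteq> U)"
  and topspace_tau_U: "topspace (tau_U :: ('a \<Rightarrow> 'b set) topology) = closed_valued"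
proof -
  let ?B = "{sup_entourage \<epsilon> :: (('a \<Rightarrow> 'b set) \<times> ('a \<Rightarrow> 'b set)) set | \<epsilon>. 0 < \<epsilon>}"
  have 1: "\<forall>B\<in>?B. B \<subseteq> closed_valued \<times> closed_valued"
    by (auto simp: sup_entourage_def)
  have "sup_entourage 1 \<in> ?B"
    by (rule CollectI, rule exI[of _ 1]) simp
  then have 2: "?B \<noteq> {}" by blast
  have 3: "\<forall>B\<in>?B. \<forall>C\<in>?B. \<exists>D\<in>?B. D \<subseteq> B \<inter> C"
  proof (intro ballI)
    fix B C assume "B \<in> ?B" "C \<in> ?B"
    obtain \<epsilon> \<epsilon>' where *: "B = sup_entourage \<epsilon>" "C = sup_entourage \<epsilon>'" "0 < \<epsilon>" "0 < \<epsilon>'"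
      using \<open>B \<in> ?B\<close> \<open>C \<in> ?B\<close> by blast
    have "sup_entourage (min \<epsilon> \<epsilon>') \<subseteq> B \<inter> C"
      unfolding * by (rule Int_greatest; rule sup_entourage_mono; simp)
    moreover have "sup_entourage (min \<epsilon> \<epsilon>') \<in> ?B"
      by (rule CollectI, rule exI[of _ "min \<epsilon> \<epsilon>'"]) (use * in simp)
    ultimately show "\<exists>D\<in>?B. D \<subseteq> B \<inter> C" by blast
  qed
  show "openin tau_U U \<longleftrightarrow> U \<subseteq> closed_valued \<and>
     (\<forall>\<Phi>\<in>U. \<exists>\<epsilon>>0. sup_entourage \<epsilon> `` {\<Phi>} \<subseteq> U)"
    unfolding tau_U_def openin_uniform_topology(1)[of ?B, OF 1 2 3] by blast
  show "topspace (tau_U :: ('a \<Rightarrow> 'b set) topology) = closed_valued"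
    unfolding tau_U_def by (rule openin_uniform_topology(2)[of ?B, OF 1 2 3])
qed

definition co_map :: "('a \<Rightarrow> 'b::real_normed_vector set) \<Rightarrow> 'a \<Rightarrow> 'b set" where
  "co_map F = (\<lambda>x. closure (convex hull (F x)))"

end

theory Submission
  imports Defs
begin

text \<open>Minimality of a usco map \<open>F\<close> means that whenever an open set \<open>W\<close> meets a value \<open>F x\<close> with
  \<open>x\<close> in an open set \<open>U\<close>, some nonempty open \<open>U' \<subseteq> U\<close> has \<open>F u \<subseteq> W\<close> for all \<open>u \<in> U'\<close>: otherwise
  removing \<open>W\<close> from the values over \<open>U\<close> leaves a smaller usco map. If \<open>G\<close> is cusco below the closed
  convex hull of \<open>F\<close> and some \<open>y \<in> F x\<close> is not in \<open>G x\<close>, take for \<open>W\<close> a small ball around \<open>y\<close>: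
  on \<open>U'\<close> the hull of \<open>F\<close> stays near \<open>y\<close> while \<open>G\<close> stays near \<open>G x\<close>, a contradiction. So the hull of
  a minimal usco map is minimal cusco. Conversely a minimal cusco map contains a minimal usco map by
  Zorn's lemma, whose hull it must be. Continuity holds because passing to closed convex hulls
  does not increase the Hausdorff distance. All this rests on the convexity of the distance function
  to a convex set; no separation theorem is needed.\<close>

section \<open>Distance to a convex set and closed convex hulls\<close>

lemma infdist_lessD:
  assumes "infdist x A < e" "A \<noteq> {}"
  obtains a where "a \<in> A" "dist x a < e"
  using assms by (auto simp: infdist_notempty cINF_less_iff)

text \<open>For nonempty \<open>B\<close> this set is the Minkowski sum of \<open>B\<close> and
  \<open>ball 0 r\<close>, and sums of convex sets are convex.\<close>

lemma convex_infdist_less: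
  fixes B :: "'b::real_normed_vector set"
  assumes "convex B"
  shows "convex {z. infdist z B < r}"
proof (cases "B = {}")
  case True
  \<comment> \<open>By convention \<open>infdist z {} = 0\<close>, so the set is empty or
    everything.\<close>
  then show ?thesis by (simp add: infdist_def)
next
  case False
  have "{z. infdist z B < r} = (\<Union>b\<in>B. \<Union>v\<in>ball 0 r. {b + v})"
  proof (intro equalityI subsetI)
    fix z assume "z \<in> {z. infdist z B < r}"
    then obtain b where "b \<in> B" "dist z b < r"
      using False by (auto elim: infdist_lessD)
    then have "z = b + (z - b)" "z - b \<in> ball 0 r" by (auto simp: dist_norm norm_minus_commute)
    with \<open>b \<in> B\<close> show "z \<in> (\<Union>b\<in>B. \<Union>v\<in>ball 0 r. {b + v})" by blast
  next
    fix z assume "z \<in> (\<Union>b\<in>B. \<Union>v\<in>ball 0 r. {b + v})"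
    then obtain b v where "b \<in> B" "norm v < r" "z = b + v" by auto
    then show "z \<in> {z. infdist z B < r}"
      using infdist_le[of b B z] by (simp add: dist_norm)
  qed
  with convex_sums[OF assms convex_ball] show ?thesis by simp
qed

text \<open>Being closed as well as convex, these neighbourhoods absorb closed convex hulls; this is
  how every hull below is bounded.\<close>

lemma convex_infdist_le:
  fixes B :: "'b::real_normed_vector set"
  assumes "convex B"
  shows "convex {z. infdist z B \<le> r}"
proof -
  have "{z. infdist z B \<le> r} = (\<Inter>e\<in>{0<..}. {z. infdist z B < r + e})"
    by (auto intro: field_le_epsilon less_imp_le)
  then show ?thesis
    by (simp add: convex_INT convex_infdist_less[OF assms])
qed

lemma closed_infdist_le: "closed {z. infdist z B \<le> r}"
  by (intro closed_Collect_le continuous_intros)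

lemma closure_convex_hull_minimal:
  assumes "A \<subseteq> C" "convex C" "closed C"
  shows "closure (convex hull A) \<subseteq> C"
  using assms by (simp add: closure_minimal hull_minimal)

lemma subset_closure_convex_hull: "A \<subseteq> closure (convex hull A)"
  using hull_subset closure_subset by (rule subset_trans)

text \<open>Mazur's theorem. A closed set in a Banach space is complete, so total boundedness
  remains: the hull of \<open>S\<close> stays close to the hull of a finite net \<open>k\<close>,
  which is compact and has a finite net of its own.\<close>

lemma compact_closure_convex_hull:
  fixes S :: "'b::banach set"
  assumes "compact S"
  shows "compact (closure (convex hull S))"
  unfolding compact_eq_totally_bounded
proof (intro conjI allI impI)
  show "complete (closure (convex hull S))" by (simp add: complete_eq_closed)
  fix e :: real assume "0 < e"
  then obtain k where k: "finite k" "S \<subseteq> (\<Union>x\<in>k. ball x (e/4))"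
    using assms unfolding compact_eq_totally_bounded by (meson zero_less_divide_iff zero_less_numeral)
  obtain k' where k': "finite k'" "convex hull k \<subseteq> (\<Union>x\<in>k'. ball x (e/2))"
    using finite_imp_compact_convex_hull[OF k(1)] \<open>0 < e\<close>
    unfolding compact_eq_totally_bounded by (meson zero_less_divide_iff zero_less_numeral)
  have "closure (convex hull S) \<subseteq> (\<Union>x\<in>k'. ball x e)"
  proof (cases "k = {}")
    case True
    then show ?thesis using k(2) by simp
  next
    case False
    have "S \<subseteq> {z. infdist z (convex hull k) \<le> e/4}"
    proof
      fix s assume "s \<in> S"
      then obtain x where "x \<in> k" "dist s x < e/4" using k(2) by (force simp: dist_commute)
      then show "s \<in> {z. infdist z (convex hull k) \<le> e/4}"
        using infdist_le2[of x "convex hull k" s "e/4"] hull_inc[of x k convex] by simp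
    qed
    then have sub: "closure (convex hull S) \<subseteq> {z. infdist z (convex hull k) \<le> e/4}"
      by (intro closure_convex_hull_minimal convex_infdist_le closed_infdist_le convex_convex_hull)
    show ?thesis
    proof
      fix z assume "z \<in> closure (convex hull S)"
      \<comment> \<open>Passing from \<open>e/4\<close> to \<open>e/2\<close> makes the bound
        strict, so a point \<open>w\<close> of the hull realises it; the net \<open>k'\<close> costs
        the other \<open>e/2\<close>.\<close>
      then have "infdist z (convex hull k) < e/2" using sub \<open>0 < e\<close> by force
      then obtain w where w: "w \<in> convex hull k" "dist z w < e/2"
        by (rule infdist_lessD) (simp add: False)
      then obtain x where "x \<in> k'" "dist x w < e/2" using k'(2) by auto
      with w have "dist x z < e" by metric
      with \<open>x \<in> k'\<close> show "z \<in> (\<Union>x\<in>k'. ball x e)" by auto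
    qed
  qed
  with k'(1) show "\<exists>k. finite k \<and> closure (convex hull S) \<subseteq> (\<Union>x\<in>k. ball x e)" by blast
qed

lemma compact_subset_open_infdist:
  assumes "compact K" "K \<noteq> {}" "open V" "K \<subseteq> V"
  obtains e where "e > 0" "{z. infdist z K \<le> e} \<subseteq> V"
proof -
  obtain e where e: "e > 0" "(\<Union>x\<in>K. ball x e) \<subseteq> V"
    using compact_subset_open_imp_ball_epsilon_subset[OF assms(1,3,4)] by blast
  \<comment> \<open>Halving \<open>e\<close> turns the open neighbourhood into a closed one.\<close>
  have "{z. infdist z K \<le> e/2} \<subseteq> V"
  proof
    fix z assume "z \<in> {z. infdist z K \<le> e/2}"
    then have "infdist z K < e" using e(1) by simp
    then obtain a where "a \<in> K" "dist z a < e" using assms(2) by (rule infdist_lessD)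
    then have "z \<in> (\<Union>x\<in>K. ball x e)" by (auto simp: dist_commute)
    then show "z \<in> V" using e(2) by blast
  qed
  with e(1) show thesis using that[of "e/2"] by simp
qed

section \<open>Minimal usco and minimal cusco maps\<close>

lemma uscD:
  assumes "usc F" "open V" "F x \<subseteq> V"
  obtains U where "open U" "x \<in> U" "\<And>u. u \<in> U \<Longrightarrow> F u \<subseteq> V"
  using assms unfolding usc_def by meson

lemma MU_open_subset:
  fixes F :: "'a::topological_space \<Rightarrow> 'b::t2_space set"
  assumes "F \<in> MU" "open U" "x \<in> U" "open W" "F x \<inter> W \<noteq> {}"
  obtains U' where "open U'" "U' \<noteq> {}" "U' \<subseteq> U" "\<And>u. u \<in> U' \<Longrightarrow> F u \<subseteq> W"
proof -
  have F: "usc F" "\<And>x. F x \<noteq> {}" "\<And>x. compact (F x)"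
    and min: "\<And>G. usco G \<Longrightarrow> G \<le> F \<Longrightarrow> G = F"
    using assms(1) unfolding MU_def usco_def by auto
  have "\<exists>v\<in>U. F v \<subseteq> W"
  proof (rule ccontr)
    assume "\<not> (\<exists>v\<in>U. F v \<subseteq> W)"
    then have ne: "F v - W \<noteq> {}" if "v \<in> U" for v using that by blast
    define G where "G = (\<lambda>v. if v \<in> U then F v - W else F v)"
    have "G \<le> F" by (auto simp: G_def le_fun_def)
    have "usc G"
      unfolding usc_def
    proof (intro allI impI, elim conjE)
      fix v V assume V: "open V" "G v \<subseteq> V"
      show "\<exists>N. open N \<and> v \<in> N \<and> (\<forall>u\<in>N. G u \<subseteq> V)"
      proof (cases "v \<in> U")
        case True
        \<comment> \<open>Upper semicontinuity of \<open>F\<close> is applied to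
          \<open>V \<union> W\<close>; inside the open set \<open>U\<close> the part in
          \<open>W\<close> is removed again.\<close>
        then have "F v \<subseteq> V \<union> W" using V by (auto simp: G_def)
        then obtain N where N: "open N" "v \<in> N" "\<And>u. u \<in> N \<Longrightarrow> F u \<subseteq> V \<union> W"
          using uscD[OF F(1) open_Un[OF V(1) assms(4)]] by metis
        have "\<forall>u\<in>N \<inter> U. G u \<subseteq> V" using N(3) by (force simp: G_def)
        with N True assms(2) show ?thesis by (intro exI[of _ "N \<inter> U"]) auto
      next
        case False
        \<comment> \<open>The neighbourhood \<open>N\<close> may meet \<open>U\<close>, but there
          \<open>G\<close> is only smaller than \<open>F\<close>.\<close>
        then have "F v \<subseteq> V" using V by (simp add: G_def)
        then obtain N where "open N" "v \<in> N" "\<And>u. u \<in> N \<Longrightarrow> F u \<subseteq> V"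
          using uscD[OF F(1) V(1)] by metis
        with \<open>G \<le> F\<close> show ?thesis by (intro exI[of _ N]) (auto simp: le_fun_def)
      qed
    qed
    then have "usco G"
      using F ne assms(4) by (auto simp: usco_def G_def intro: compact_diff)
    then have "G = F" using \<open>G \<le> F\<close> by (rule min)
    then have "G x = F x" by (rule fun_cong)
    then have "F x - W = F x" using assms(3) by (simp add: G_def)
    then show False using assms(5) by blast
  qed
  then obtain v where v: "v \<in> U" "F v \<subseteq> W" by blast
  then obtain N where "open N" "v \<in> N" "\<And>u. u \<in> N \<Longrightarrow> F u \<subseteq> W"
    using uscD[OF F(1) assms(4)] by metis
  then show thesis
    using v assms(2) by (intro that[of "N \<inter> U"]) auto
qed

text \<open>A compact convex value inside \<open>V\<close> has a closed convex neighbourhood inside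
  \<open>V\<close>. It contains the nearby values of \<open>F\<close>, hence also their closed
  hulls.\<close>

lemma cusco_co_map:
  fixes F :: "'a::topological_space \<Rightarrow> 'b::banach set"
  assumes "usco F"
  shows "cusco (co_map F)"
proof -
  have F: "usc F" "\<And>x. F x \<noteq> {}" "\<And>x. compact (F x)"
    using assms unfolding usco_def by auto
  have comp: "compact (co_map F x)" and ne: "co_map F x \<noteq> {}" and conv: "convex (co_map F x)" for x
    using F(2,3) by (simp_all add: co_map_def compact_closure_convex_hull convex_closure)
  have "usc (co_map F)"
    unfolding usc_def
  proof (intro allI impI, elim conjE)
    fix x V assume V: "open V" "co_map F x \<subseteq> V"
    obtain e where e: "e > 0" "{z. infdist z (co_map F x) \<le> e} \<subseteq> V"
      using compact_subset_open_infdist[OF comp ne V] .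
    have "open {z. infdist z (co_map F x) < e}"
      by (intro open_Collect_less continuous_intros)
    moreover have "F x \<subseteq> {z. infdist z (co_map F x) < e}"
      using e(1) subset_closure_convex_hull[of "F x"] by (auto simp: co_map_def)
    ultimately obtain N where N: "open N" "x \<in> N"
      "\<And>u. u \<in> N \<Longrightarrow> F u \<subseteq> {z. infdist z (co_map F x) < e}"
      using uscD[OF F(1)] by metis
    have "co_map F u \<subseteq> V" if "u \<in> N" for u
    proof -
      have "F u \<subseteq> {z. infdist z (co_map F x) \<le> e}" using N(3)[OF that] by force
      then have "co_map F u \<subseteq> {z. infdist z (co_map F x) \<le> e}"
        unfolding co_map_def[of F, THEN fun_cong, of u]
        by (intro closure_convex_hull_minimal convex_infdist_le closed_infdist_le conv)
      with e(2) show ?thesis by blast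
    qed
    with N show "\<exists>N. open N \<and> x \<in> N \<and> (\<forall>u\<in>N. co_map F u \<subseteq> V)" by blast
  qed
  with comp ne conv show ?thesis by (simp add: cusco_def usco_def)
qed

lemma co_map_least:
  assumes "cusco G" "F \<le> G"
  shows "co_map F \<le> G"
  unfolding le_fun_def co_map_def
  using assms by (intro allI closure_convex_hull_minimal)
    (auto simp: cusco_def usco_def le_fun_def intro: compact_imp_closed)

lemma co_map_MC:
  fixes F :: "'a::topological_space \<Rightarrow> 'b::banach set"
  assumes "F \<in> MU"
  shows "co_map F \<in> MC"
proof -
  have "usco F" using assms by (simp add: MU_def)
  \<comment> \<open>This suffices, since \<open>co_map F\<close> is the least cusco map above
    \<open>F\<close>.\<close>
  have "F \<le> G" if G: "cusco G" "G \<le> co_map F" for G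
  proof (rule ccontr)
    assume "\<not> F \<le> G"
    then obtain x y where y: "y \<in> F x" "y \<notin> G x" by (auto simp: le_fun_def)
    have Gx: "closed (G x)" "G x \<noteq> {}" "convex (G x)" "usc G"
      using G(1) by (auto simp: cusco_def usco_def compact_imp_closed)
    \<comment> \<open>Half the distance makes \<open>cball y r\<close> disjoint from the open
      \<open>r\<close>-neighbourhood of \<open>G x\<close>.\<close>
    define r where "r = infdist y (G x) / 2"
    have "r > 0" using infdist_pos_not_in_closed[OF Gx(1,2) y(2)] by (simp add: r_def)
    have "open {z. infdist z (G x) < r}"
      by (intro open_Collect_less continuous_intros)
    moreover have "G x \<subseteq> {z. infdist z (G x) < r}" using \<open>r > 0\<close> by auto
    ultimately obtain N where N: "open N" "x \<in> N"
      "\<And>u. u \<in> N \<Longrightarrow> G u \<subseteq> {z. infdist z (G x) < r}"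
      using uscD[OF Gx(4)] by metis
    have "F x \<inter> ball y r \<noteq> {}" using y \<open>r > 0\<close> by auto
    then obtain N' where "N' \<noteq> {}" "N' \<subseteq> N" and N': "\<And>u. u \<in> N' \<Longrightarrow> F u \<subseteq> ball y r"
      using MU_open_subset[OF assms N(1,2) open_ball] by metis
    then obtain u where u: "u \<in> N'" "u \<in> N" by blast
    have "co_map F u \<subseteq> cball y r"
      using N'[OF u(1)] unfolding co_map_def
      by (intro closure_convex_hull_minimal convex_cball closed_cball) auto
    moreover obtain z where "z \<in> G u" using G(1) by (auto simp: cusco_def usco_def)
    ultimately have "dist y z \<le> r" "infdist z (G x) < r"
      using le_funD[OF G(2), of u] N(3)[OF u(2)] by auto
    then show False using infdist_triangle[of y "G x" z] by (simp add: r_def)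
  qed
  then have "G = co_map F" if "cusco G" "G \<le> co_map F" for G
    using that co_map_least by (metis antisym)
  with cusco_co_map[OF \<open>usco F\<close>] show ?thesis unfolding MC_def by blast
qed

section \<open>Existence of minimal usco maps below a usco map\<close>

lemma usco_INF_chain:
  fixes C :: "('a::topological_space \<Rightarrow> 'b::t2_space set) set"
  assumes "C \<noteq> {}" and usco: "\<And>G. G \<in> C \<Longrightarrow> usco G"
    and chain: "\<And>G H. G \<in> C \<Longrightarrow> H \<in> C \<Longrightarrow> G \<le> H \<or> H \<le> G"
  shows "usco (\<lambda>x. \<Inter>G\<in>C. G x)"
proof -
  have G: "compact (G x)" "G x \<noteq> {}" "usc G" if "G \<in> C" for G x
    using usco[OF that] by (auto simp: usco_def)
  \<comment> \<open>Otherwise the sets \<open>G x - V\<close> form a chain of nonempty compact sets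
    with empty intersection. This yields both upper semicontinuity and, with \<open>V = {}\<close>,
    nonempty values.\<close>
  have below: "\<exists>G\<in>C. G x \<subseteq> V" if V: "open V" "(\<Inter>G\<in>C. G x) \<subseteq> V" for x V
  proof (rule ccontr)
    assume "\<not> (\<exists>G\<in>C. G x \<subseteq> V)"
    then have ne: "G x - V \<noteq> {}" if "G \<in> C" for G using that by blast
    obtain G\<^sub>0 where "G\<^sub>0 \<in> C" using \<open>C \<noteq> {}\<close> by blast
    have "G\<^sub>0 x \<inter> (\<Inter>G\<in>C. G x - V) \<noteq> {}"
    proof (rule compact_imp_fip_image)
      show "compact (G\<^sub>0 x)" using G(1)[OF \<open>G\<^sub>0 \<in> C\<close>] .
      show "closed (G x - V)" if "G \<in> C" for G
        using G(1)[OF that] V(1) by (simp add: closed_Diff compact_imp_closed)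
      fix D assume "finite D" "D \<subseteq> C"
      \<comment> \<open>A finite part of a chain has a lower bound in the chain; including
        \<open>G\<^sub>0\<close>, the ambient compact map, also covers empty
        \<open>D\<close>.\<close>
      then have "\<exists>H\<in>C. \<forall>G\<in>insert G\<^sub>0 D. H \<le> G"
      proof (induction D rule: finite_induct)
        case empty
        then show ?case using \<open>G\<^sub>0 \<in> C\<close> by auto
      next
        case (insert G D)
        then obtain H where H: "H \<in> C" "\<And>K. K \<in> insert G\<^sub>0 D \<Longrightarrow> H \<le> K" by auto
        have "G \<in> C" using insert.prems by simp
        with H(1) have "G \<le> H \<or> H \<le> G" using chain by blast
        then show ?case
        proof
          assume "G \<le> H"
          then have "\<forall>K\<in>insert G\<^sub>0 (insert G D). G \<le> K" using H(2) by (blast intro: order_trans)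
          with \<open>G \<in> C\<close> show ?thesis by blast
        next
          assume "H \<le> G"
          then have "\<forall>K\<in>insert G\<^sub>0 (insert G D). H \<le> K" using H(2) by auto
          with H(1) show ?thesis by blast
        qed
      qed
      then obtain H where H: "H \<in> C" "\<And>G. G \<in> insert G\<^sub>0 D \<Longrightarrow> H \<le> G" by blast
      have "H x \<subseteq> G x" if "G \<in> insert G\<^sub>0 D" for G using H(2)[OF that] by (rule le_funD)
      then have "H x - V \<subseteq> G\<^sub>0 x \<inter> (\<Inter>G\<in>D. G x - V)" by blast
      with ne[OF H(1)] show "G\<^sub>0 x \<inter> (\<Inter>G\<in>D. G x - V) \<noteq> {}" by blast
    qed
    then obtain z where "\<And>G. G \<in> C \<Longrightarrow> z \<in> G x - V" by blast
    then have "z \<in> (\<Inter>G\<in>C. G x)" "z \<notin> V" using \<open>G\<^sub>0 \<in> C\<close> by auto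
    with V(2) show False by blast
  qed
  have "compact (\<Inter>G\<in>C. G x)" for x
  proof -
    obtain G\<^sub>0 where "G\<^sub>0 \<in> C" using \<open>C \<noteq> {}\<close> by blast
    then have "(\<Inter>G\<in>C. G x) = G\<^sub>0 x \<inter> (\<Inter>G\<in>C. G x)" by blast
    moreover have "compact (G\<^sub>0 x \<inter> (\<Inter>G\<in>C. G x))"
      using G(1) \<open>G\<^sub>0 \<in> C\<close> by (intro compact_Int_closed closed_INT) (auto intro: compact_imp_closed)
    ultimately show ?thesis by simp
  qed
  moreover have "(\<Inter>G\<in>C. G x) \<noteq> {}" for x
    using below[of "{}" x] G(2) by force
  moreover have "usc (\<lambda>x. \<Inter>G\<in>C. G x)"
    unfolding usc_def
  proof (intro allI impI, elim conjE)
    fix x V assume V: "open V" "(\<Inter>G\<in>C. G x) \<subseteq> V"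
    then obtain G where "G \<in> C" "G x \<subseteq> V" using below by blast
    then obtain N where "open N" "x \<in> N" "\<And>u. u \<in> N \<Longrightarrow> G u \<subseteq> V"
      using uscD[OF G(3) V(1)] by metis
    with \<open>G \<in> C\<close> show "\<exists>N. open N \<and> x \<in> N \<and> (\<forall>u\<in>N. (\<Inter>G\<in>C. G u) \<subseteq> V)"
      by (intro exI[of _ N]) blast
  qed
  ultimately show ?thesis by (simp add: usco_def)
qed

lemma ex_MU_le_usco:
  fixes \<Phi> :: "'a::topological_space \<Rightarrow> 'b::t2_space set"
  assumes "usco \<Phi>"
  obtains F where "F \<in> MU" "F \<le> \<Phi>"
proof -
  let ?A = "{G. usco G \<and> G \<le> \<Phi>}"
  \<comment> \<open>The order is reversed, so that a maximal element in Zorn's lemma is a minimal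
    map.\<close>
  let ?P = "\<lambda>G H :: 'a \<Rightarrow> 'b set. H \<le> G"
  have "\<exists>m\<in>?A. \<forall>a\<in>?A. ?P m a \<longrightarrow> a = m"
  proof (rule predicate_Zorn)
    show "partial_order_on ?A (relation_of ?P ?A)"
      by (rule partial_order_on_relation_ofI) auto
    fix C assume C: "C \<in> Chains (relation_of ?P ?A)"
    show "\<exists>u\<in>?A. \<forall>a\<in>C. ?P a u"
    proof (cases "C = {}")
      case True
      \<comment> \<open>The bound for the empty chain is \<open>\<Phi>\<close>, because an empty
        intersection would be \<open>UNIV\<close>.\<close>
      then show ?thesis using assms by auto
    next
      case False
      have "usco G" "G \<le> \<Phi>" if "G \<in> C" for G
        using C that by (auto simp: Chains_def relation_of_def)
      moreover have "G \<le> H \<or> H \<le> G" if "G \<in> C" "H \<in> C" for G H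
        using C that by (auto simp: Chains_def relation_of_def)
      ultimately have "usco (\<lambda>x. \<Inter>G\<in>C. G x)" "(\<lambda>x. \<Inter>G\<in>C. G x) \<le> \<Phi>"
        using False usco_INF_chain[of C] by (blast, fastforce simp: le_fun_def)
      then show ?thesis by (intro bexI[of _ "\<lambda>x. \<Inter>G\<in>C. G x"]) (auto simp: le_fun_def)
    qed
  qed
  then obtain F where F: "usco F" "F \<le> \<Phi>" "\<And>G. usco G \<Longrightarrow> G \<le> \<Phi> \<Longrightarrow> G \<le> F \<Longrightarrow> G = F" by auto
  \<comment> \<open>Any usco map below \<open>F\<close> is below \<open>\<Phi>\<close>, so
    minimality in \<open>?A\<close> is minimality among all usco maps.\<close>
  then have "F \<in> MU" unfolding MU_def using order_trans by blast
  with F(2) show thesis by (rule that[rotated -1])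
qed

lemma co_map_image_MU: "co_map ` MU = (MC :: ('a::topological_space \<Rightarrow> 'b::banach set) set)"
proof (intro equalityI subsetI)
  show "\<Phi> \<in> MC" if "\<Phi> \<in> co_map ` MU" for \<Phi> :: "'a \<Rightarrow> 'b set"
    using that co_map_MC by auto
  fix \<Phi> :: "'a \<Rightarrow> 'b set" assume "\<Phi> \<in> MC"
  then have \<Phi>: "cusco \<Phi>" "\<And>G. cusco G \<Longrightarrow> G \<le> \<Phi> \<Longrightarrow> G = \<Phi>" unfolding MC_def by auto
  then obtain F where F: "F \<in> MU" "F \<le> \<Phi>" using ex_MU_le_usco unfolding cusco_def by blast
  then have "co_map F = \<Phi>"
    using \<Phi> by (intro \<Phi>(2) cusco_co_map co_map_least) (auto simp: MU_def)
  with F(1) show "\<Phi> \<in> co_map ` MU" by blast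
qed

section \<open>Closed convex hulls do not increase the Hausdorff distance\<close>

text \<open>If the excess is a real \<open>r\<close>, then \<open>A\<close> lies in the closed
  convex set of points within \<open>r\<close> of the hull of \<open>B\<close>, and so does its
  closed hull. An infinite excess is trivial.\<close>

lemma excess_closure_convex_hull:
  fixes A B :: "'b::real_normed_vector set"
  assumes "B \<noteq> {}"
  shows "excess (closure (convex hull A)) (closure (convex hull B)) \<le> excess A B"
proof (cases "excess A B")
  case (real r)
  let ?B = "closure (convex hull B)"
  have "infdist a ?B \<le> r" if "a \<in> A" for a
  proof -
    have "ennreal (infdist a B) \<le> ennreal r"
      using SUP_upper[OF that, of "\<lambda>a. ennreal (infdist a B)"] real by (simp add: excess_def)
    then have "infdist a B \<le> r" using real by (simp add: ennreal_le_iff)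
    then show ?thesis
      using infdist_mono[OF subset_closure_convex_hull assms, of a] by simp
  qed
  then have "closure (convex hull A) \<subseteq> {z. infdist z ?B \<le> r}"
    by (intro closure_convex_hull_minimal convex_infdist_le closed_infdist_le
        convex_closure convex_convex_hull) auto
  then show ?thesis
    unfolding real excess_def[of "closure (convex hull A)"] by (intro SUP_least ennreal_leI) auto
qed simp

lemma Hausdorff_edist_co_map:
  assumes "F \<in> closed_valued" "G \<in> closed_valued"
  shows "Hausdorff_edist (co_map F x) (co_map G x) \<le> Hausdorff_edist (F x) (G x)"
  using assms unfolding Hausdorff_edist_def co_map_def closed_valued_def
  by (intro max.mono excess_closure_convex_hull) auto

section \<open>Continuity for the three topologies\<close>

lemma co_map_closed_valued: "F \<in> closed_valued \<Longrightarrow> co_map F \<in> closed_valued"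
  by (simp add: closed_valued_def co_map_def)

lemma co_map_entourage:
  assumes "(F, G) \<in> entourage A \<epsilon>"
  shows "(co_map F, co_map G) \<in> entourage A \<epsilon>"
  using assms Hausdorff_edist_co_map[of F G] co_map_closed_valued
  unfolding entourage_def by (fastforce intro: order.strict_trans1)

lemma co_map_sup_entourage:
  assumes "(F, G) \<in> sup_entourage \<epsilon>"
  shows "(co_map F, co_map G) \<in> sup_entourage \<epsilon>"
proof -
  have FG: "F \<in> closed_valued" "G \<in> closed_valued" "sup_edist F G < ennreal \<epsilon>"
    using assms by (auto simp: sup_entourage_def)
  have "sup_edist (co_map F) (co_map G) \<le> sup_edist F G"
    unfolding sup_edist_def by (intro SUP_mono' Hausdorff_edist_co_map FG)
  then show ?thesis
    using FG by (auto simp: sup_entourage_def co_map_closed_valued)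
qed

text \<open>Common argument for the three topologies: \<open>co_map\<close> maps each basic
  entourage into itself, so the \<open>B\<close> chosen at \<open>co_map F\<close> also serves at
  \<open>F\<close>.\<close>

lemma continuous_map_co_map:
  fixes \<tau> :: "('a \<Rightarrow> 'b::real_normed_vector set) topology"
  assumes openin: "\<And>U. openin \<tau> U \<longleftrightarrow> U \<subseteq> closed_valued \<and> (\<forall>\<Phi>\<in>U. \<exists>B\<in>\<B>. B `` {\<Phi>} \<subseteq> U)"
    and topspace: "topspace \<tau> = closed_valued"
    and total: "\<And>B. B \<in> \<B> \<Longrightarrow> B \<subseteq> closed_valued \<times> closed_valued"
    and co_map: "\<And>B F G. B \<in> \<B> \<Longrightarrow> (F, G) \<in> B \<Longrightarrow> (co_map F, co_map G) \<in> B"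
  shows "continuous_map \<tau> \<tau> co_map"
  unfolding continuous_map topspace
proof (intro conjI allI impI)
  show "co_map ` closed_valued \<subseteq> closed_valued" using co_map_closed_valued by auto
  fix U assume U: "openin \<tau> U"
  show "openin \<tau> {F \<in> closed_valued. co_map F \<in> U}"
    unfolding openin
  proof (intro conjI ballI)
    fix F assume "F \<in> {F \<in> closed_valued. co_map F \<in> U}"
    then obtain B where B: "B \<in> \<B>" "B `` {co_map F} \<subseteq> U"
      using U unfolding openin by blast
    have "B `` {F} \<subseteq> {F \<in> closed_valued. co_map F \<in> U}"
      using B(2) co_map[OF B(1)] total[OF B(1)] by blast
    with B(1) show "\<exists>B\<in>\<B>. B `` {F} \<subseteq> {F \<in> closed_valued. co_map F \<in> U}" by blast
  qed auto
qed

lemma continuous_map_tau_p: "continuous_map tau_p tau_p co_map"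
  by (rule continuous_map_co_map[where \<B> = "{entourage A \<epsilon> | A \<epsilon>. A \<noteq> {} \<and> finite A \<and> 0 < \<epsilon>}"])
    (simp add: openin_tau_p, blast, rule topspace_tau_p, force simp: entourage_def, blast intro: co_map_entourage)

lemma continuous_map_tau_UC: "continuous_map tau_UC tau_UC co_map"
  by (rule continuous_map_co_map[where \<B> = "{entourage K \<epsilon> | K \<epsilon>. K \<noteq> {} \<and> compact K \<and> 0 < \<epsilon>}"])
    (simp add: openin_tau_UC, blast, rule topspace_tau_UC, force simp: entourage_def, blast intro: co_map_entourage)

lemma continuous_map_tau_U: "continuous_map tau_U tau_U co_map"
  by (rule continuous_map_co_map[where \<B> = "{sup_entourage \<epsilon> | \<epsilon>. 0 < \<epsilon>}"])
    (simp add: openin_tau_U, blast, rule topspace_tau_U, force simp: sup_entourage_def, blast intro: co_map_sup_entourage)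

theorem theorem3p1:
  fixes \<tau> :: "('a::t2_space \<Rightarrow> 'b::banach set) topology"
  assumes "\<tau> \<in> {tau_p, tau_UC, tau_U}"
  shows "co_map ` (MU :: ('a \<Rightarrow> 'b set) set) = MC \<and>
    continuous_map (subtopology \<tau> MU) (subtopology \<tau> MC) co_map"
proof
  show "co_map ` (MU :: ('a \<Rightarrow> 'b set) set) = MC" by (rule co_map_image_MU)
  \<comment> \<open>Continuity holds on all closed-valued maps; restriction to \<open>MU\<close> and
    \<open>MC\<close> then uses only \<open>co_map_MC\<close>.\<close>
  have "continuous_map \<tau> \<tau> co_map"
    using assms continuous_map_tau_p continuous_map_tau_UC continuous_map_tau_U by auto
  then show "continuous_map (subtopology \<tau> MU) (subtopology \<tau> MC) co_map"
    by (auto simp: continuous_map_in_subtopology continuous_map_from_subtopology co_map_MC)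
qed

end
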